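(* Let $n$ be a positive integer, let $D$ be a condition on families of subsets of $[n]$, and let $\mathcal{F}\subset 2^{[n]}$ be a family satisfying $D$. Then $|\mathcal{F}|\le S(n,D)$.
   Context: $[n]=\{1,2,\dots,n\}$ and $2^{[n]}$ is the family of all subsets of $[n]$. A condition $D$ is an arbitrary property (predicate) that a family $\mathcal{F}\subset 2^{[n]}$ may or may not satisfy. A full chain is a family $\mathcal{C}=\{A_0,A_1,\dots,A_n\}$ of sets $A_i\in 2^{[n]}$ with $|A_i|=i$ for all $i$ and $A_i\subset A_{i+1}$ for every $0\le i<n$. Let $\mathfrak{C}_n$ denote the set of all $n!$ full chains in $2^{[n]}$. For a family $\mathcal{F}\subset 2^{[n]}$ and a set $G\subset [n]$, let $\omega_{\mathcal{F}}(G)=\binom{n}{|G|}$ if $G\in\mathcal{F}$ and $\omega_{\mathcal{F}}(G)=0$ otherwise. Define $$s(\mathcal{F})=\max_{\mathcal{C}\in\mathfrak{C}_n}\sum_{G\in\mathcal{C}}\omega_{\mathcal{F}}(G),$$ and $$S(n,D)=\max\{s(\mathcal{F}') : \mathcal{F}'\subset 2^{[n]},\ \mathcal{F}' \text{ satisfies } D\}.$$ *)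

theory Defs
  imports Main
begin

definition full_chain :: "nat \<Rightarrow> nat set set \<Rightarrow> bool" where
  "full_chain n C \<longleftrightarrow>
     (\<exists>A. C = A ` {0..n} \<and>
          (\<forall>i\<le>n. A i \<subseteq> {1..n} \<and> card (A i) = i) \<and>
          (\<forall>i<n. A i \<subseteq> A (Suc i)))"

definition full_chains :: "nat \<Rightarrow> nat set set set" where
  "full_chains n = {C. full_chain n C}"

definition omega :: "nat \<Rightarrow> nat set set \<Rightarrow> nat set \<Rightarrow> nat" where
  "omega n F G = (if G \<in> F then n choose card G else 0)"

(* Max ranges over a finite nonempty set here: there are finitely many full chains in
   the power set of {1..n}, and at least one. *)
definition max_chain_weight :: "nat \<Rightarrow> nat set set \<Rightarrow> nat" where
  "max_chain_weight n F = Max ((\<lambda>C. \<Sum>G\<in>C. omega n F G) ` full_chains n)"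

(* The set under Max is finite; it is nonempty exactly when some family of subsets of
   {1..n} satisfies D, and the value is meaningful only in that case. *)
definition S_max :: "nat \<Rightarrow> (nat set set \<Rightarrow> bool) \<Rightarrow> nat" where
  "S_max n D = Max {max_chain_weight n F' | F'. F' \<subseteq> Pow {1..n} \<and> D F'}"

end

theory Submission
  imports Defs Complex_Main
begin

text \<open>
  Some full chain carries at least the expected weight of a uniformly random one, and a random
  full chain passes through \<open>G\<close> with probability \<open>1 / (n choose |G|)\<close>, so the expected weight of
  \<^term>\<open>omega n F\<close> is exactly \<^term>\<open>card F\<close>. The averaging is done one level at a time: the
  second largest member of a random chain in \<open>A\<close> is \<open>A - {x}\<close> for a uniformly random
  \<open>x \<in> A\<close>, and the best \<open>x\<close> is chosen by pigeonhole, so no chains are counted.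
\<close>

text \<open>Double counting: a proper subset \<open>G\<close> of \<open>A\<close> lies in
  \<open>A - {x}\<close> for exactly the \<open>Suc m - card G\<close> elements \<open>x\<close> of
  \<open>A\<close> outside \<open>G\<close>, and absorption turns this multiplicity over
  \<open>m choose card G\<close> into \<open>Suc m\<close> over \<open>Suc m choose card G\<close>.
  The set \<open>A\<close> itself lies in no \<open>A - {x}\<close>.\<close>

lemma sum_proper_subsets_eq_average:
  fixes v :: "'a set \<Rightarrow> real"
  assumes A: "finite A" and cA: "card A = Suc m"
  shows "(\<Sum>x\<in>A. \<Sum>G\<in>Pow (A - {x}). v G / real (m choose card G)) =
    real (Suc m) * (\<Sum>G\<in>Pow A - {A}. v G / real (Suc m choose card G))"
proof -
  have "(\<Sum>x\<in>A. \<Sum>G\<in>Pow (A - {x}). v G / real (m choose card G)) =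
      (\<Sum>x\<in>A. \<Sum>G\<in>{G \<in> Pow A - {A}. x \<notin> G}. v G / real (m choose card G))"
    by (intro sum.cong) auto
  also have "\<dots> = (\<Sum>G\<in>Pow A - {A}. \<Sum>x\<in>{x \<in> A. x \<notin> G}. v G / real (m choose card G))"
    using A by (intro sum.swap_restrict) auto
  also have "\<dots> = (\<Sum>G\<in>Pow A - {A}. real (Suc m) * (v G / real (Suc m choose card G)))"
  proof (intro sum.cong refl)
    fix G assume "G \<in> Pow A - {A}"
    then have G: "G \<subset> A" by auto
    then have less: "card G < Suc m"
      using psubset_card_mono[OF A] cA by simp
    have "{x \<in> A. x \<notin> G} = A - G" by auto
    then have c: "card {x \<in> A. x \<notin> G} = Suc m - card G"
      using card_Diff_subset[of G A] finite_subset[of G A] G A cA by auto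
    have "(Suc m - card G) * (Suc m choose card G) = Suc m * (m choose card G)"
      using binomial_absorb_comp[of "Suc m" "card G"] by simp
    then have "real (Suc m - card G) * real (Suc m choose card G) =
        real (Suc m) * real (m choose card G)"
      by (metis of_nat_mult)
    \<comment> \<open>As \<open>G\<close> is a proper subset, \<open>card G\<close> is at most
      \<open>m\<close>, so neither denominator vanishes and cross-multiplying is legitimate.\<close>
    moreover have "real (Suc m choose card G) > 0" "real (m choose card G) > 0"
      using less by (auto simp: zero_less_binomial_iff simp del: binomial_Suc_Suc)
    ultimately have "real (Suc m - card G) / real (m choose card G) =
        real (Suc m) / real (Suc m choose card G)"
      by (simp add: frac_eq_eq)
    then have "v G * (real (Suc m - card G) / real (m choose card G)) =
        v G * (real (Suc m) / real (Suc m choose card G))"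
      by (rule arg_cong)
    with c show "(\<Sum>x\<in>{x \<in> A. x \<notin> G}. v G / real (m choose card G)) =
        real (Suc m) * (v G / real (Suc m choose card G))"
      by (simp add: mult.commute)
  qed
  finally show ?thesis by (simp only: sum_distrib_left)
qed

text \<open>The set \<open>A\<close> is arbitrary because the induction descends to
  \<open>A - {x}\<close>, which need not be an initial segment.\<close>

lemma exists_chain_sum_ge_average:
  fixes v :: "'a set \<Rightarrow> real"
  assumes "finite A" "card A = m"
  shows "\<exists>c. (\<forall>i\<le>m. c i \<subseteq> A \<and> card (c i) = i) \<and> (\<forall>i<m. c i \<subseteq> c (Suc i)) \<and>
    (\<Sum>G\<in>Pow A. v G / real (m choose card G)) \<le> (\<Sum>i\<le>m. v (c i))"
  using assms
proof (induction m arbitrary: A)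
  case 0
  then show ?case by (intro exI[of _ "\<lambda>_. {}"]) auto
next
  case (Suc m)
  let ?T = "\<Sum>G\<in>Pow A - {A}. v G / real (Suc m choose card G)"
  let ?R = "\<lambda>x. \<Sum>G\<in>Pow (A - {x}). v G / real (m choose card G)"
  \<comment> \<open>By the averaging identity, \<open>?T\<close> is the mean of \<open>?R x\<close>
    over the \<open>Suc m\<close> elements of \<open>A\<close>, so some \<open>?R x\<close> reaches
    it.\<close>
  have "\<exists>x\<in>A. ?T \<le> ?R x"
  proof (rule ccontr)
    assume "\<not> (\<exists>x\<in>A. ?T \<le> ?R x)"
    then have "(\<Sum>x\<in>A. ?R x) < (\<Sum>x\<in>A. ?T)"
      using Suc.prems by (intro sum_strict_mono) auto
    then show False
      using sum_proper_subsets_eq_average[OF Suc.prems, of v] Suc.prems(2) by simp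
  qed
  then obtain x where x: "x \<in> A" "?T \<le> ?R x" by blast
  have "finite (A - {x})" "card (A - {x}) = m"
    using Suc.prems x(1) by auto
  from Suc.IH[OF this] obtain c where
    c: "\<forall>i\<le>m. c i \<subseteq> A - {x} \<and> card (c i) = i" "\<forall>i<m. c i \<subseteq> c (Suc i)"
      "?R x \<le> (\<Sum>i\<le>m. v (c i))"
    by blast
  \<comment> \<open>The chain in \<open>A - {x}\<close> is capped by \<open>A\<close>, whose own
    term has denominator \<open>Suc m choose Suc m\<close>, that is 1.\<close>
  let ?c = "c(Suc m := A)"
  have "(\<Sum>G\<in>Pow A. v G / real (Suc m choose card G)) = v A + ?T"
    using Suc.prems by (subst sum.remove[of _ A]) auto
  also have "\<dots> \<le> (\<Sum>i\<le>Suc m. v (?c i))"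
    using x(2) c(3) by simp
  finally have "(\<Sum>G\<in>Pow A. v G / real (Suc m choose card G)) \<le> (\<Sum>i\<le>Suc m. v (?c i))" .
  moreover have "\<forall>i\<le>Suc m. ?c i \<subseteq> A \<and> card (?c i) = i"
    using c(1) Suc.prems(2) by (auto simp: le_Suc_eq)
  moreover have "\<forall>i<Suc m. ?c i \<subseteq> ?c (Suc i)"
    using c(1,2) by (auto simp: less_Suc_eq)
  ultimately show ?case by blast
qed

lemma finite_full_chains: "finite (full_chains n)"
proof (rule finite_subset)
  show "full_chains n \<subseteq> Pow (Pow {1..n})"
    unfolding full_chains_def full_chain_def by fastforce
qed simp

text \<open>With \<open>omega n F\<close> as weight, the binomials cancel: each member of
  \<open>F\<close> adds 1 to the average and every other set adds 0.\<close>

lemma card_le_max_chain_weight: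
  assumes F: "F \<subseteq> Pow {1..n}"
  shows "card F \<le> max_chain_weight n F"
proof -
  let ?v = "\<lambda>G. real (omega n F G)"
  obtain c where
    c: "\<forall>i\<le>n. c i \<subseteq> {1..n} \<and> card (c i) = i" "\<forall>i<n. c i \<subseteq> c (Suc i)"
      "(\<Sum>G\<in>Pow {1..n}. ?v G / real (n choose card G)) \<le> (\<Sum>i\<le>n. ?v (c i))"
    using exists_chain_sum_ge_average[of "{1..n}" n ?v] by auto
  have "real (card F) = (\<Sum>G\<in>F. ?v G / real (n choose card G))"
  proof -
    have "?v G / real (n choose card G) = 1" if "G \<in> F" for G
    proof -
      have "card G \<le> n"
        using that F card_mono[of "{1..n}" G] by auto
      with that show ?thesis by (simp add: omega_def)
    qed
    then have "(\<Sum>G\<in>F. ?v G / real (n choose card G)) = (\<Sum>G\<in>F. 1)"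
      by (rule sum.cong[OF refl])
    then show ?thesis by simp
  qed
  also have "\<dots> = (\<Sum>G\<in>Pow {1..n}. ?v G / real (n choose card G))"
    using F by (intro sum.mono_neutral_left) (auto simp: omega_def)
  also have "\<dots> \<le> real (\<Sum>i\<le>n. omega n F (c i))"
    using c(3) by simp
  finally have "card F \<le> (\<Sum>i\<le>n. omega n F (c i))" by linarith
  also have "\<dots> = (\<Sum>G\<in>c ` {0..n}. omega n F G)"
  proof -
    \<comment> \<open>\<open>card\<close> is a left inverse of \<open>c\<close>, so summing over
      indices equals summing over the chain as a set.\<close>
    have "inj_on c {0..n}"
      using c(1) by (intro inj_on_inverseI[of _ card]) auto
    then show ?thesis by (simp add: sum.reindex atMost_atLeast0)
  qed
  also have "\<dots> \<le> max_chain_weight n F"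
    unfolding max_chain_weight_def
  proof (intro Max_ge imageI)
    show "c ` {0..n} \<in> full_chains n"
      using c(1,2) unfolding full_chains_def full_chain_def by blast
  qed (simp add: finite_full_chains)
  finally show ?thesis .
qed

theorem theorem2p3:
  fixes n :: nat and D :: "nat set set \<Rightarrow> bool" and F :: "nat set set"
  assumes "n > 0"
    and "F \<subseteq> Pow {1..n}"
    and "D F"
  shows "card F \<le> S_max n D"
proof -
  have "max_chain_weight n F \<le> S_max n D"
    unfolding S_max_def
  proof (rule Max_ge)
    \<comment> \<open>\<open>D\<close> is arbitrary, so finiteness comes from the values over all
      families of subsets.\<close>
    have "finite (max_chain_weight n ` Pow (Pow {1..n}))" by simp
    then show "finite {max_chain_weight n F' | F'. F' \<subseteq> Pow {1..n} \<and> D F'}"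
      by (rule rev_finite_subset) auto
  qed (use assms in blast)
  with card_le_max_chain_weight[OF assms(2)] show ?thesis by linarith
qed

end
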